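(* Let $R=\{(0,0),(0,1),(2,0),(3,0),(1,3),(2,1),(2,2),(2,3),(3,3)\}$ and $R'=\{(0,0),(0,2),(0,3),(1,0),(1,2),(2,2),(3,1),(3,2),(3,3)\}$. Then $(123,R)\sim_{jd}(132,R)$ and $(123,R')\sim_{jd}(132,R')$.
   Context: $S_n$ is the set of permutations $\pi=\pi_1\cdots\pi_n$ of $\{1,\dots,n\}$. A mesh pattern of length $k$ is a pair $(\tau,R)$ with $\tau\in S_k$ and $R\subseteq\{0,\dots,k\}\times\{0,\dots,k\}$ (the set of shaded boxes; box $(a,b)$ is the unit square with lower-left corner $(a,b)$). An occurrence of $(\tau,R)$ in $\pi\in S_n$ is a subsequence $\pi_{i_1}\cdots\pi_{i_k}$, $i_1<\dots<i_k$, order-isomorphic to $\tau$, such that, with $i_0=0$, $i_{k+1}=n+1$, with $v_1<\dots<v_k$ the values $\pi_{i_1},\dots,\pi_{i_k}$ in increasing order, and $v_0=0$, $v_{k+1}=n+1$, for each $(a,b)\in R$ there is no index $m$ with $i_a<m<i_{a+1}$ and $v_b<\pi_m<v_{b+1}$. Two mesh patterns $q_1,q_2$ are jointly equidistributed, written $q_1\sim_{jd}q_2$, if for all nonnegative integers $n,k,\ell$ the number of $\pi\in S_n$ with exactly $k$ occurrences of $q_1$ and $\ell$ occurrences of $q_2$ equals the number of $\pi\in S_n$ with exactly $\ell$ occurrences of $q_1$ and $k$ occurrences of $q_2$. *)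

theory Defs
  imports "HOL-Combinatorics.Combinatorics"
begin

text \<open>A mesh pattern \<open>(\<tau>, R)\<close> of length \<open>k\<close> carries \<open>\<tau> \<in> S\<^sub>k\<close> as the word \<open>[\<tau>\<^sub>1, \<dots>, \<tau>\<^sub>k]\<close>.
  The permutations in which patterns are counted are functions \<open>\<pi>\<close> with \<open>\<pi> permutes {1..n}\<close>, so that
  \<open>\<pi> m\<close> is the \<open>m\<close>-th letter of \<open>\<pi>\<close>.\<close>

type_synonym mesh_pattern = "nat list \<times> (nat \<times> nat) set"

definition is_mesh_pattern :: "mesh_pattern \<Rightarrow> bool" where
  "is_mesh_pattern q \<longleftrightarrow> (case q of (\<tau>, R) \<Rightarrow>
     \<tau> \<in> permutations_of_set {1..length \<tau>} \<and> R \<subseteq> {0..length \<tau>} \<times> {0..length \<tau>})"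

definition order_isomorphic :: "nat list \<Rightarrow> nat list \<Rightarrow> bool" where
  "order_isomorphic xs ys \<longleftrightarrow> length xs = length ys \<and>
     (\<forall>i < length xs. \<forall>j < length xs. xs ! i < xs ! j \<longleftrightarrow> ys ! i < ys ! j)"

text \<open>An occurrence is represented by its list of positions \<open>[i\<^sub>1, \<dots>, i\<^sub>k]\<close>. In the lists \<open>ps\<close> and \<open>vs\<close>
  below, the entries with index \<open>a\<close> and \<open>b\<close> are \<open>i\<^sub>a\<close> and \<open>v\<^sub>b\<close>, including the boundary values
  \<open>i\<^sub>0 = v\<^sub>0 = 0\<close> and \<open>i\<^bsub>k+1\<^esub> = v\<^bsub>k+1\<^esub> = n + 1\<close>.\<close>

definition is_occurrence :: "nat \<Rightarrow> mesh_pattern \<Rightarrow> (nat \<Rightarrow> nat) \<Rightarrow> nat list \<Rightarrow> bool" where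
  "is_occurrence n q \<pi> is \<longleftrightarrow> (case q of (\<tau>, R) \<Rightarrow>
     set is \<subseteq> {1..n} \<and> sorted_wrt (<) is \<and> order_isomorphic (map \<pi> is) \<tau> \<and>
     (let ps = 0 # is @ [n + 1]; vs = 0 # sort (map \<pi> is) @ [n + 1] in
        \<forall>(a, b) \<in> R. \<not> (\<exists>m \<in> {1..n}. ps ! a < m \<and> m < ps ! (a + 1) \<and> vs ! b < \<pi> m \<and> \<pi> m < vs ! (b + 1))))"

definition num_occurrences :: "nat \<Rightarrow> mesh_pattern \<Rightarrow> (nat \<Rightarrow> nat) \<Rightarrow> nat" where
  "num_occurrences n q \<pi> = card {is. is_occurrence n q \<pi> is}"

definition jointly_equidistributed :: "mesh_pattern \<Rightarrow> mesh_pattern \<Rightarrow> bool" (infix "\<sim>\<^sub>j\<^sub>d" 50) where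
  "q1 \<sim>\<^sub>j\<^sub>d q2 \<longleftrightarrow> (\<forall>n k l.
     card {\<pi>. \<pi> permutes {1..n} \<and> num_occurrences n q1 \<pi> = k \<and> num_occurrences n q2 \<pi> = l} =
     card {\<pi>. \<pi> permutes {1..n} \<and> num_occurrences n q1 \<pi> = l \<and> num_occurrences n q2 \<pi> = k})"

definition R1 :: "(nat \<times> nat) set" where
  "R1 = {(0,0), (0,1), (2,0), (3,0), (1,3), (2,1), (2,2), (2,3), (3,3)}"

definition R2 :: "(nat \<times> nat) set" where
  "R2 = {(0,0), (0,2), (0,3), (1,0), (1,2), (2,2), (3,1), (3,2), (3,3)}"

lemma is_mesh_pattern_123_132:
  assumes "\<tau> \<in> {[1, 2, 3], [1, 3, 2]}" "R \<in> {R1, R2}"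
  shows "is_mesh_pattern (\<tau>, R)"
  using assms by (auto simp: is_mesh_pattern_def permutations_of_set_def R1_def R2_def)

lemma finite_occurrences: "finite {is. is_occurrence n q \<pi> is}"
proof (rule finite_subset)
  show "{is. is_occurrence n q \<pi> is} \<subseteq> {is. set is \<subseteq> {1..n} \<and> length is = length (fst q)}"
    by (auto simp: is_occurrence_def order_isomorphic_def)
qed (simp add: finite_lists_length_eq)

end

theory Submission
  imports Defs
begin

text \<open>For \<open>R1\<close> the last two letters of an occurrence are adjacent, and shading forces any two
  occurrences of the same pattern in a permutation to coincide; \<open>R2\<close> is the transpose of \<open>R1\<close> and both
  123 and 132 are involutions, so inverting permutations transfers this to \<open>R2\<close>. Hence both counts are
  0 or 1, and it suffices that as many permutations contain the first pattern as the second. Swapping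
  the last two letters of the occurrence is a bijection, for the letters of an occurrence never lie in
  the interior of a box.\<close>

section \<open>Occurrences of the two patterns in a common form\<close>

definition boxes_empty ::
  "nat \<Rightarrow> (nat \<times> nat) set \<Rightarrow> (nat \<Rightarrow> nat) \<Rightarrow> nat list \<Rightarrow> nat list \<Rightarrow> bool" where
  "boxes_empty n R \<pi> is vs \<longleftrightarrow>
     (let ps = 0 # is @ [n + 1]; vs' = 0 # vs @ [n + 1] in
        \<forall>(a, b) \<in> R. \<not> (\<exists>m \<in> {1..n}. ps ! a < m \<and> m < ps ! (a + 1) \<and> vs' ! b < \<pi> m \<and> \<pi> m < vs' ! (b + 1)))"

text \<open>Covers 123 and 132 at once: in both, the increasing values are \<open>\<pi> i\<close>,
  then the smaller and the larger of the last two letters, so the shaded regions are given by the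
  same bounds. Only the comparison of \<open>\<pi> j\<close> with \<open>\<pi> k\<close> tells the
  patterns apart.\<close>

definition occ_1xx :: "nat \<Rightarrow> (nat \<times> nat) set \<Rightarrow> (nat \<Rightarrow> nat) \<Rightarrow> nat \<Rightarrow> nat \<Rightarrow> nat \<Rightarrow> bool" where
  "occ_1xx n R \<pi> i j k \<longleftrightarrow> 0 < i \<and> i < j \<and> j < k \<and> k \<le> n \<and> \<pi> i < min (\<pi> j) (\<pi> k) \<and>
     boxes_empty n R \<pi> [i, j, k] [\<pi> i, min (\<pi> j) (\<pi> k), max (\<pi> j) (\<pi> k)]"

lemma length_3_conv: "length xs = 3 \<longleftrightarrow> (\<exists>i j k. xs = [i, j, k])"
  by (auto simp: numeral_3_eq_3 length_Suc_conv)

lemma is_occurrence_length: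
  "is_occurrence n (\<tau>, R) \<pi> is \<Longrightarrow> length is = length \<tau>"
  by (auto simp: is_occurrence_def order_isomorphic_def)

lemma order_isomorphic_123: "order_isomorphic [x, y, z] [1, 2, 3] \<longleftrightarrow> x < y \<and> y < z"
  by (auto simp: order_isomorphic_def less_Suc_eq numeral_3_eq_3)

lemma order_isomorphic_132: "order_isomorphic [x, y, z] [1, 3, 2] \<longleftrightarrow> x < z \<and> z < y"
  by (auto simp: order_isomorphic_def less_Suc_eq numeral_3_eq_3)

lemma is_occurrence_123_iff:
  "is_occurrence n ([1, 2, 3], R) \<pi> is \<longleftrightarrow>
     (\<exists>i j k. is = [i, j, k] \<and> occ_1xx n R \<pi> i j k \<and> \<pi> j < \<pi> k)"
proof (cases "length is = 3")
  case True
  then obtain i j k where "is = [i, j, k]" by (auto simp: length_3_conv)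
  then show ?thesis
    by (auto simp: is_occurrence_def occ_1xx_def boxes_empty_def order_isomorphic_123[simplified]
        min_def max_def)
qed (auto dest: is_occurrence_length)

lemma is_occurrence_132_iff:
  "is_occurrence n ([1, 3, 2], R) \<pi> is \<longleftrightarrow>
     (\<exists>i j k. is = [i, j, k] \<and> occ_1xx n R \<pi> i j k \<and> \<pi> k < \<pi> j)"
proof (cases "length is = 3")
  case True
  then obtain i j k where "is = [i, j, k]" by (auto simp: length_3_conv)
  then show ?thesis
    by (auto simp: is_occurrence_def occ_1xx_def boxes_empty_def order_isomorphic_132[simplified]
        min_def max_def)
qed (auto dest: is_occurrence_length)

section \<open>Swapping the last two letters and inverting the permutation\<close>

lemma boxes_empty_cong:
  assumes R: "R \<subseteq> {0..length is} \<times> {0..length vs}" and "sorted_wrt (<) is" "set is \<subseteq> {1..n}"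
    and eq: "\<And>m. m \<notin> set is \<Longrightarrow> \<pi> m = \<sigma> m"
    and "boxes_empty n R \<pi> is vs"
  shows "boxes_empty n R \<sigma> is vs"
proof -
  let ?ps = "0 # is @ [n + 1]"
  have ps: "sorted_wrt (<) ?ps"
    using assms(2,3) by (fastforce simp: sorted_wrt_append)
  \<comment> \<open>Positions of the occurrence lie on the vertical grid lines, never strictly
    inside a column. The bound on \<open>a\<close> keeps \<open>a + 1\<close> a valid index of
    \<open>?ps\<close>.\<close>
  have off: "m \<notin> set is" if "a \<le> length is" "?ps ! a < m" "m < ?ps ! (a + 1)" for a m
  proof
    assume "m \<in> set is"
    then obtain c where c: "c < length ?ps" "m = ?ps ! c"
      by (metis in_set_conv_nth list.set_intros(2) append_Cons Un_iff set_append)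
    have "a < c"
      using that(2) c sorted_wrt_nth_less[OF ps, of c a] that(1) by (cases a c rule: linorder_cases) auto
    moreover have "c < a + 1"
      using that(3) c sorted_wrt_nth_less[OF ps, of "a + 1" c]
      by (cases c "a + 1" rule: linorder_cases) auto
    ultimately show False by simp
  qed
  show ?thesis
    unfolding boxes_empty_def Let_def
  proof (clarify)
    fix a b m
    assume *: "(a, b) \<in> R" "m \<in> {1..n}" "?ps ! a < m" "m < ?ps ! (a + 1)"
      "(0 # vs @ [n + 1]) ! b < \<sigma> m" "\<sigma> m < (0 # vs @ [n + 1]) ! (b + 1)"
    from * R have "m \<notin> set is" by (intro off[of a]) auto
    then have "\<sigma> m = \<pi> m" using eq by simp
    with * assms(5) show False unfolding boxes_empty_def Let_def by fastforce
  qed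
qed

text \<open>The swap preserves the minimum and the maximum of the last two letters, so the grid
  stays fixed and only points on its lines move.\<close>

lemma occ_1xx_swap:
  assumes "R \<subseteq> {0..3} \<times> {0..3}" "occ_1xx n R \<pi> i j k"
  shows "occ_1xx n R (\<pi> \<circ> transpose j k) i j k"
proof -
  have "boxes_empty n R (\<pi> \<circ> transpose j k) [i, j, k] [\<pi> i, min (\<pi> j) (\<pi> k), max (\<pi> j) (\<pi> k)]"
    by (rule boxes_empty_cong[of _ _ _ _ \<pi>])
      (use assms in \<open>auto simp: occ_1xx_def transpose_def numeral_3_eq_3\<close>)
  with assms(2) show ?thesis
    by (auto simp: occ_1xx_def transpose_def min.commute max.commute)
qed

text \<open>Inversion reflects the plot of \<open>\<pi>\<close> in the main diagonal, so columns and
  rows of the grid exchange roles. Taking positions and values as two separate lists in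
  \<open>boxes_empty\<close> makes this symmetry visible.\<close>

lemma boxes_empty_inv:
  assumes "\<pi> permutes {1..n}" "boxes_empty n R \<pi> is vs"
  shows "boxes_empty n (R\<inverse>) (inv \<pi>) vs is"
  unfolding boxes_empty_def Let_def
proof (clarify)
  fix a b m
  assume *: "(a, b) \<in> R" "m \<in> {1..n}" "(0 # vs @ [n + 1]) ! b < m" "m < (0 # vs @ [n + 1]) ! (b + 1)"
    "(0 # is @ [n + 1]) ! a < inv \<pi> m" "inv \<pi> m < (0 # is @ [n + 1]) ! (a + 1)"
  have "inv \<pi> m \<in> {1..n}"
    using *(2) permutes_in_image[OF permutes_inv[OF assms(1)]] by blast
  moreover have "\<pi> (inv \<pi> m) = m"
    using permutes_inverses(1)[OF assms(1)] .
  ultimately show False using * assms(2) unfolding boxes_empty_def Let_def by fastforce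
qed

lemma permutes_eq_iff: "\<pi> permutes A \<Longrightarrow> \<pi> x = \<pi> y \<longleftrightarrow> x = y"
  by (simp add: inj_eq permutes_inj)

lemma occ_1xx_inv:
  assumes p: "\<pi> permutes {1..n}" and "occ_1xx n R \<pi> i j k"
  shows "occ_1xx n (R\<inverse>) (inv \<pi>) (\<pi> i) (min (\<pi> j) (\<pi> k)) (max (\<pi> j) (\<pi> k))"
proof -
  have o: "0 < i" "i < j" "j < k" "k \<le> n" "\<pi> i < min (\<pi> j) (\<pi> k)"
    and b: "boxes_empty n R \<pi> [i, j, k] [\<pi> i, min (\<pi> j) (\<pi> k), max (\<pi> j) (\<pi> k)]"
    using assms(2) by (auto simp: occ_1xx_def)
  have rng: "\<pi> i \<in> {1..n}" "\<pi> j \<in> {1..n}" "\<pi> k \<in> {1..n}"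
    using o(1-4) unfolding permutes_in_image[OF p] by auto
  have "\<pi> j \<noteq> \<pi> k"
    using o by (simp add: permutes_eq_iff[OF p])
  \<comment> \<open>The inverse sends the two larger values back to \<open>j\<close> and
    \<open>k\<close> in an order that depends on the pattern; taking minimum and maximum covers both
    cases.\<close>
  then have inv: "inv \<pi> (\<pi> i) = i" "min (inv \<pi> (min (\<pi> j) (\<pi> k))) (inv \<pi> (max (\<pi> j) (\<pi> k))) = j"
    "max (inv \<pi> (min (\<pi> j) (\<pi> k))) (inv \<pi> (max (\<pi> j) (\<pi> k))) = k"
    and less: "min (\<pi> j) (\<pi> k) < max (\<pi> j) (\<pi> k)"
    using o(3) by (auto simp: permutes_inverses(2)[OF p] min_def max_def)
  show ?thesis
    unfolding occ_1xx_def inv using o rng less boxes_empty_inv[OF p b] by simp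
qed

section \<open>Uniqueness of the occurrence of each pattern\<close>

lemma occ_1xx_R1D:
  assumes p: "\<pi> permutes {1..n}" and "occ_1xx n R1 \<pi> i j k"
  shows "k = Suc j" "m \<in> {1..<i} \<Longrightarrow> min (\<pi> j) (\<pi> k) < \<pi> m"
    "m \<in> {j..n} \<Longrightarrow> \<pi> i \<le> \<pi> m" "m \<in> {i..n} \<Longrightarrow> \<pi> m \<le> max (\<pi> j) (\<pi> k)"
proof -
  have o: "0 < i" "i < j" "j < k" "k \<le> n" "\<pi> i < \<pi> j" "\<pi> i < \<pi> k"
    and b: "boxes_empty n R1 \<pi> [i, j, k] [\<pi> i, min (\<pi> j) (\<pi> k), max (\<pi> j) (\<pi> k)]"
    using assms(2) by (auto simp: occ_1xx_def)
  note inj = permutes_eq_iff[OF p]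
  \<comment> \<open>One conjunct per shaded box. Column 2 is shaded entirely, hence
    \<open>k = Suc j\<close>; (0,0) and (0,1) force up the letters before \<open>i\<close>; (2,0)
    and (3,0) bound the letters from \<open>j\<close> on from below; (1,3), (2,3) and (3,3) bound
    those from \<open>i\<close> on from above.\<close>
  have cells: "\<not> (m < i \<and> \<pi> m < \<pi> i) \<and> \<not> (m < i \<and> \<pi> i < \<pi> m \<and> \<pi> m < min (\<pi> j) (\<pi> k)) \<and>
      \<not> (j < m \<and> m < k \<and> \<pi> m < \<pi> i) \<and> \<not> (k < m \<and> \<pi> m < \<pi> i) \<and>
      \<not> (i < m \<and> m < j \<and> max (\<pi> j) (\<pi> k) < \<pi> m) \<and>
      \<not> (j < m \<and> m < k \<and> \<pi> i < \<pi> m \<and> \<pi> m < min (\<pi> j) (\<pi> k)) \<and>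
      \<not> (j < m \<and> m < k \<and> min (\<pi> j) (\<pi> k) < \<pi> m \<and> \<pi> m < max (\<pi> j) (\<pi> k)) \<and>
      \<not> (j < m \<and> m < k \<and> max (\<pi> j) (\<pi> k) < \<pi> m) \<and>
      \<not> (k < m \<and> max (\<pi> j) (\<pi> k) < \<pi> m)" if "m \<in> {1..n}" for m
  proof -
    have "\<pi> m \<in> {1..n}"
      using that permutes_in_image[OF p] by blast
    moreover note that b
    moreover define y z where "y = min (\<pi> j) (\<pi> k)" and "z = max (\<pi> j) (\<pi> k)"
    ultimately show ?thesis
      unfolding y_def[symmetric] z_def[symmetric] boxes_empty_def R1_def
      by (simp add: numeral_2_eq_2 numeral_3_eq_3) (auto simp: Ball_def less_Suc_eq_le)
  qed
  have off: "\<pi> m \<noteq> \<pi> i \<and> \<pi> m \<noteq> min (\<pi> j) (\<pi> k) \<and> \<pi> m \<noteq> max (\<pi> j) (\<pi> k)"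
    if "m \<noteq> i" "m \<noteq> j" "m \<noteq> k" for m
    using that by (auto simp: inj min_def max_def)
  show "k = Suc j"
  proof (rule ccontr)
    assume "k \<noteq> Suc j"
    then show False
      using o cells[of "Suc j"] off[of "Suc j"] by (auto simp: not_less)
  qed
  show "min (\<pi> j) (\<pi> k) < \<pi> m" if "m \<in> {1..<i}"
    using that o cells[of m] off[of m] by (force simp: not_less)
  show "\<pi> i \<le> \<pi> m" if "m \<in> {j..n}"
    using that o cells[of m]
    by (cases "m = j"; cases "m = k"; cases "m < k") (auto simp: not_less)
  show "\<pi> m \<le> max (\<pi> j) (\<pi> k)" if "m \<in> {i..n}"
  proof -
    have "(m = i \<or> m = j \<or> m = k) \<or> (i < m \<and> m < j \<or> j < m \<and> m < k \<or> k < m)"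
      using that by auto
    then consider "m = i \<or> m = j \<or> m = k" | "i < m \<and> m < j \<or> j < m \<and> m < k \<or> k < m"
      by blast
    then show ?thesis
    proof cases
      case 2
      have "m \<in> {1..n}"
        using that o(1) by auto
      with 2 cells[of m] show ?thesis
        by (elim disjE conjE) (simp_all only: not_less simp_thms)
    qed (use o in auto)
  qed
qed

text \<open>The largest letter of an occurrence is the maximum from its first letter on, and the first letter
  is a left-to-right minimum. The first occurrence therefore has to reach beyond the start of the
  second, so that both share their maximum, and then the other letters as well.\<close>

lemma occ_1xx_R1_unique_aux:
  assumes p: "\<pi> permutes {1..n}"
    and o: "occ_1xx n R1 \<pi> i j k" "occ_1xx n R1 \<pi> i' j' k'"
    and ori: "\<pi> j < \<pi> k \<longleftrightarrow> \<pi> j' < \<pi> k'" and "i \<le> i'"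
  shows "i = i' \<and> j = j' \<and> k = k'"
proof -
  note d = occ_1xx_R1D[OF p o(1)] and d' = occ_1xx_R1D[OF p o(2)]
  have b: "0 < i" "i < j" "k \<le> n" "\<pi> i < min (\<pi> j) (\<pi> k)"
    "0 < i'" "i' < j'" "k' \<le> n" "\<pi> i' < min (\<pi> j') (\<pi> k')"
    using o by (auto simp: occ_1xx_def)
  note inj = permutes_eq_iff[OF p]
  have less: "min (\<pi> j') (\<pi> k') < \<pi> i" if "i < i'"
    using that b d'(2)[of i] by auto
  have reach: "i' \<le> j"
  proof (rule ccontr)
    assume "\<not> i' \<le> j"
    \<comment> \<open>From \<open>j\<close> on no letter is below \<open>\<pi> i\<close>, yet
      \<open>\<pi> i'\<close> is below the smaller of its own last two letters, which
      \<open>less\<close> puts below \<open>\<pi> i\<close>.\<close>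
    then show False
      using b d(3)[of i'] d'(1) less by (auto simp: min_less_iff_disj)
  qed
  have "max (\<pi> j) (\<pi> k) = max (\<pi> j') (\<pi> k')"
  proof (rule antisym)
    show "max (\<pi> j) (\<pi> k) \<le> max (\<pi> j') (\<pi> k')"
      using reach b d(1) d'(4)[of j] d'(4)[of k] by simp
    show "max (\<pi> j') (\<pi> k') \<le> max (\<pi> j) (\<pi> k)"
      using \<open>i \<le> i'\<close> b d'(1) d(4)[of j'] d(4)[of k'] by simp
  qed
  \<comment> \<open>The common orientation tells whether the shared maximum stands at the second or
    the third position, and these two are adjacent.\<close>
  then have "j = j'"
    using ori d(1) d'(1) inj by (auto simp: max_def split: if_splits)
  \<comment> \<open>With the last two letters shared, \<open>i < i'\<close> would by
    \<open>less\<close> put \<open>\<pi> i\<close> above the smaller of them.\<close>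
  then show ?thesis
    using \<open>i \<le> i'\<close> less b d(1) d'(1) by (cases "i = i'") auto
qed

text \<open>The equivalence restricts the claim to two occurrences of the same pattern. A general
  \<open>R\<close> allows the passage to the converse shading.\<close>

definition occ_unique :: "nat \<Rightarrow> (nat \<times> nat) set \<Rightarrow> bool" where
  "occ_unique n R \<longleftrightarrow> (\<forall>\<pi> i j k i' j' k'. \<pi> permutes {1..n} \<longrightarrow>
     occ_1xx n R \<pi> i j k \<longrightarrow> occ_1xx n R \<pi> i' j' k' \<longrightarrow> (\<pi> j < \<pi> k \<longleftrightarrow> \<pi> j' < \<pi> k') \<longrightarrow>
     i = i' \<and> j = j' \<and> k = k')"

lemma occ_unique_R1: "occ_unique n R1"
  unfolding occ_unique_def
proof (intro allI impI)
  fix \<pi> i j k i' j' k'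
  assume "\<pi> permutes {1..n}" "occ_1xx n R1 \<pi> i j k" "occ_1xx n R1 \<pi> i' j' k'"
    "\<pi> j < \<pi> k \<longleftrightarrow> \<pi> j' < \<pi> k'"
  then show "i = i' \<and> j = j' \<and> k = k'"
    using occ_1xx_R1_unique_aux[of \<pi> n i j k i' j' k'] occ_1xx_R1_unique_aux[of \<pi> n i' j' k' i j k]
    by (cases "i \<le> i'") auto
qed

text \<open>Occurrences for the converse shading in \<open>\<pi>\<close> become occurrences for
  \<open>R\<close> in \<open>inv \<pi>\<close>, where uniqueness is assumed.\<close>

lemma occ_unique_converse:
  assumes "occ_unique n R"
  shows "occ_unique n (R\<inverse>)"
  unfolding occ_unique_def
proof (intro allI impI)
  fix \<pi> i j k i' j' k'
  assume p: "\<pi> permutes {1..n}" and o: "occ_1xx n (R\<inverse>) \<pi> i j k" "occ_1xx n (R\<inverse>) \<pi> i' j' k'"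
    and ori: "\<pi> j < \<pi> k \<longleftrightarrow> \<pi> j' < \<pi> k'"
  note inj = permutes_eq_iff[OF p]
  \<comment> \<open>Inversion keeps the orientation, because 123 and 132 are involutions.\<close>
  have ori': "inv \<pi> (min (\<pi> j) (\<pi> k)) < inv \<pi> (max (\<pi> j) (\<pi> k)) \<longleftrightarrow> \<pi> j < \<pi> k"
    if "occ_1xx n S \<pi> i j k" for S i j k
  proof -
    have "\<pi> j \<noteq> \<pi> k"
      using that inj by (simp add: occ_1xx_def)
    then show ?thesis
      using that by (auto simp: occ_1xx_def permutes_inverses[OF p] min_def max_def)
  qed
  have "\<pi> i = \<pi> i' \<and> min (\<pi> j) (\<pi> k) = min (\<pi> j') (\<pi> k') \<and> max (\<pi> j) (\<pi> k) = max (\<pi> j') (\<pi> k')"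
    using assms permutes_inv[OF p] occ_1xx_inv[OF p o(1)] occ_1xx_inv[OF p o(2)]
      ori'[OF o(1)] ori'[OF o(2)] ori
    unfolding occ_unique_def converse_converse by blast
  \<comment> \<open>Injectivity turns equal values into equal positions; \<open>ori\<close> decides
    whether the minimum or the maximum stands at \<open>j\<close>.\<close>
  then show "i = i' \<and> j = j' \<and> k = k'"
    using ori inj by (auto simp: min_def max_def split: if_splits)
qed

section \<open>Counting permutations by their numbers of occurrences\<close>

lemma num_occurrences_le_1:
  assumes "occ_unique n R" "\<pi> permutes {1..n}" "\<tau> \<in> {[1, 2, 3], [1, 3, 2]}"
  shows "num_occurrences n (\<tau>, R) \<pi> \<le> 1"
proof -
  have "is = is'" if "is_occurrence n (\<tau>, R) \<pi> is" "is_occurrence n (\<tau>, R) \<pi> is'" for "is" is'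
  proof -
    have "\<exists>i j k i' j' k'. is = [i, j, k] \<and> is' = [i', j', k'] \<and>
        occ_1xx n R \<pi> i j k \<and> occ_1xx n R \<pi> i' j' k' \<and> (\<pi> j < \<pi> k \<longleftrightarrow> \<pi> j' < \<pi> k')"
    proof (cases "\<tau> = [1, 2, 3]")
      case True
      show ?thesis
        using that unfolding True is_occurrence_123_iff by blast
    next
      case False
      then have "\<tau> = [1, 3, 2]"
        using assms(3) by blast
      show ?thesis
        using that unfolding \<open>\<tau> = [1, 3, 2]\<close> is_occurrence_132_iff
        by (elim exE conjE) (simp add: order_less_not_sym)
    qed
    then show ?thesis
      using assms(1,2) unfolding occ_unique_def by blast
  qed
  then show ?thesis
    unfolding num_occurrences_def
    using card_le_Suc0_iff_eq[OF finite_occurrences] by auto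
qed

lemma num_occurrences_eq_0_iff: "num_occurrences n q \<pi> = 0 \<longleftrightarrow> (\<forall>is. \<not> is_occurrence n q \<pi> is)"
  using finite_occurrences[of n q \<pi>] by (auto simp: num_occurrences_def)

text \<open>By uniqueness, forgetting the occurrence in a pair of permutation and occurrence is
  injective. The assumption on \<open>P\<close> gives all counted occurrences one orientation, as
  uniqueness requires.\<close>

lemma card_containing_eq_card_occ:
  assumes u: "occ_unique n R"
    and P: "\<And>x y x' y'. P x y \<Longrightarrow> P x' y' \<Longrightarrow> (x < y \<longleftrightarrow> x' < y')"
  shows "card {\<pi>. \<pi> permutes {1..n} \<and> (\<exists>i j k. occ_1xx n R \<pi> i j k \<and> P (\<pi> j) (\<pi> k))} =
    card {(\<pi>, i, j, k). \<pi> permutes {1..n} \<and> occ_1xx n R \<pi> i j k \<and> P (\<pi> j) (\<pi> k)}" (is "card ?A = card ?B")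
proof -
  have "inj_on fst ?B"
  proof (rule inj_onI)
    fix x y
    assume "x \<in> ?B" "y \<in> ?B" "fst x = fst y"
    then obtain \<pi> i j k i' j' k' where *: "x = (\<pi>, i, j, k)" "y = (\<pi>, i', j', k')" "\<pi> permutes {1..n}"
      "occ_1xx n R \<pi> i j k" "occ_1xx n R \<pi> i' j' k'" "P (\<pi> j) (\<pi> k)" "P (\<pi> j') (\<pi> k')"
      by auto
    then have "\<pi> j < \<pi> k \<longleftrightarrow> \<pi> j' < \<pi> k'" using P[of "\<pi> j" "\<pi> k" "\<pi> j'" "\<pi> k'"] by blast
    then show "x = y" using u * unfolding occ_unique_def by blast
  qed
  moreover have "fst ` ?B = ?A"
    by force
  ultimately show ?thesis
    using card_image[of fst ?B] by simp
qed

lemma card_containing_123_eq_132: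
  assumes u: "occ_unique n R" and R: "R \<subseteq> {0..3} \<times> {0..3}"
  shows "card {\<pi>. \<pi> permutes {1..n} \<and> num_occurrences n ([1, 2, 3], R) \<pi> \<noteq> 0} =
    card {\<pi>. \<pi> permutes {1..n} \<and> num_occurrences n ([1, 3, 2], R) \<pi> \<noteq> 0}"
proof -
  let ?S = "\<lambda>P. {(\<pi>, i, j, k). \<pi> permutes {1..n} \<and> occ_1xx n R \<pi> i j k \<and> P (\<pi> j) (\<pi> k)}"
  let ?f = "\<lambda>(\<pi>, i, j, k). (\<pi> \<circ> transpose j k, i :: nat, j, k)"
  have sw: "\<pi> \<circ> transpose j k permutes {1..n}" if "\<pi> permutes {1..n}" "occ_1xx n R \<pi> i j k" for \<pi> i j k
    using that by (intro permutes_compose permutes_swap_id) (auto simp: occ_1xx_def)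
  \<comment> \<open>Carrying the positions along tells which letters to swap back, so
    \<open>?f\<close> is its own inverse; it reverses the comparison of the last two
    letters.\<close>
  have "bij_betw ?f (?S (<)) (?S (\<lambda>y z. z < y))"
    by (rule bij_betw_byWitness[where f' = ?f])
      (auto simp: fun_eq_iff occ_1xx_swap[OF R] sw[simplified])
  then have "card (?S (<)) = card (?S (\<lambda>y z. z < y))"
    by (rule bij_betw_same_card)
  moreover have "card {\<pi>. \<pi> permutes {1..n} \<and> (\<exists>i j k. occ_1xx n R \<pi> i j k \<and> \<pi> j < \<pi> k)} = card (?S (<))"
    by (rule card_containing_eq_card_occ[OF u]) simp
  moreover have "card {\<pi>. \<pi> permutes {1..n} \<and> (\<exists>i j k. occ_1xx n R \<pi> i j k \<and> \<pi> k < \<pi> j)} =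
      card (?S (\<lambda>y z. z < y))"
    by (rule card_containing_eq_card_occ[OF u]) simp
  ultimately show ?thesis
    by (simp add: num_occurrences_eq_0_iff is_occurrence_123_iff[simplified]
        is_occurrence_132_iff[simplified] cong: conj_cong)
qed

text \<open>Only the levels (1,0) and (0,1) need comparing: each is what remains of the support of
  one function once the common level (1,1) is removed, and the two supports have equal size.\<close>

lemma card_0_1_levels_commute:
  fixes f g :: "'a \<Rightarrow> nat"
  assumes fin: "finite A" and le: "\<And>x. x \<in> A \<Longrightarrow> f x \<le> 1" "\<And>x. x \<in> A \<Longrightarrow> g x \<le> 1"
    and eq: "card {x \<in> A. f x \<noteq> 0} = card {x \<in> A. g x \<noteq> 0}"
  shows "card {x \<in> A. f x = k \<and> g x = l} = card {x \<in> A. f x = l \<and> g x = k}"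
proof -
  have split: "card {x \<in> A. h x \<noteq> 0} =
      card {x \<in> A. h x = 1 \<and> h' x = 0} + card {x \<in> A. h x = 1 \<and> h' x = 1}"
    if "\<And>x. x \<in> A \<Longrightarrow> h x \<le> 1" "\<And>x. x \<in> A \<Longrightarrow> h' x \<le> 1" for h h' :: "'a \<Rightarrow> nat"
  proof -
    have "{x \<in> A. h x \<noteq> 0} = {x \<in> A. h x = 1 \<and> h' x = 0} \<union> {x \<in> A. h x = 1 \<and> h' x = 1}"
      using that by (force simp: le_Suc_eq)
    then show ?thesis
      using fin by (subst card_Un_disjoint[symmetric]) auto
  qed
  have 10: "card {x \<in> A. f x = 1 \<and> g x = 0} = card {x \<in> A. f x = 0 \<and> g x = 1}"
    using split[of f g] split[of g f] le eq by (simp add: conj_commute)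
  have big: "{x \<in> A. f x = a \<and> g x = b} = {}" if "a > 1 \<or> b > 1" for a b
    using that le by force
  consider "k = l" | "k = 0" "l = 1" | "k = 1" "l = 0" | "k > 1 \<or> l > 1"
    by linarith
  then show ?thesis
  proof cases
    case 4
    then have "l > 1 \<or> k > 1" by blast
    with 4 show ?thesis by (simp only: big)
  qed (use 10 in simp_all)
qed

lemma jointly_equidistributed_123_132:
  assumes "\<And>n. occ_unique n R" "R \<subseteq> {0..3} \<times> {0..3}"
  shows "([1, 2, 3], R) \<sim>\<^sub>j\<^sub>d ([1, 3, 2], R)"
  unfolding jointly_equidistributed_def
proof (intro allI)
  fix n k l
  show "card {\<pi>. \<pi> permutes {1..n} \<and>
        num_occurrences n ([1, 2, 3], R) \<pi> = k \<and> num_occurrences n ([1, 3, 2], R) \<pi> = l} =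
      card {\<pi>. \<pi> permutes {1..n} \<and>
        num_occurrences n ([1, 2, 3], R) \<pi> = l \<and> num_occurrences n ([1, 3, 2], R) \<pi> = k}"
    using card_0_1_levels_commute[of "{\<pi>. \<pi> permutes {1..n}}"
        "num_occurrences n ([1, 2, 3], R)" "num_occurrences n ([1, 3, 2], R)" k l]
      num_occurrences_le_1[OF assms(1)] card_containing_123_eq_132[OF assms]
    by (simp add: finite_permutations)
qed

theorem theorem5p1:
  shows "([1, 2, 3], R1) \<sim>\<^sub>j\<^sub>d ([1, 3, 2], R1) \<and> ([1, 2, 3], R2) \<sim>\<^sub>j\<^sub>d ([1, 3, 2], R2)"
proof
  show "([1, 2, 3], R1) \<sim>\<^sub>j\<^sub>d ([1, 3, 2], R1)"
    by (intro jointly_equidistributed_123_132 occ_unique_R1) (auto simp: R1_def)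
  have subset_R: "R2 \<subseteq> {0..3} \<times> {0..3}"
    by (auto simp: R2_def)
  have "R2 = R1\<inverse>"
    by (auto simp: R1_def R2_def)
  then show "([1, 2, 3], R2) \<sim>\<^sub>j\<^sub>d ([1, 3, 2], R2)"
    using jointly_equidistributed_123_132[OF _ subset_R] occ_unique_converse[OF occ_unique_R1]
    by metis
qed

end
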